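(* Let $f:\mathbb{R}^p\to\mathbb{R}\cup\{\infty\}$ and $g:\mathbb{R}^q\to\mathbb{R}\cup\{\infty\}$ be closed, proper, convex functions, $A\in\mathbb{R}^{n\times p}$, $B\in\mathbb{R}^{n\times q}$, $c\in\mathbb{R}^n$, $\gamma>0$, and assume \[ (\mathrm{range}\,A^T)\cap\mathrm{ri}\,\mathrm{dom}(f^* )\neq\emptyset,\qquad (\mathrm{range}\,B^T)\cap\mathrm{ri}\,\mathrm{dom}(g^* )\neq\emptyset . \] Let $(x^k,y^k,\nu^k)$, $k\ge1$, be any sequence generated by ADMM. Suppose $d^\star=p^\star\in[-\infty,\infty)$ and the primal problem (P-ADMM) is feasible but has no solution. Then $Ax^k+By^k-c\to 0$, \[ \lim_{k\to\infty}\frac1k\sum_{i=1}^{k}\bigl(f(x^i)+g(y^i)\bigr)=p^\star,\qquad \liminf_{k\to\infty}\bigl(f(x^k)+g(y^k)\bigr)=p^\star , \] and the sequence $(x^k,y^k)$ does not converge.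
   Context: A convex function is closed if its epigraph is closed, and proper if it is finite somewhere. $\mathrm{dom}$ is the effective domain (where the function is $<\infty$), $\mathrm{ri}$ the relative interior, and $f^*(\nu)=\sup_x\{\langle\nu,x\rangle-f(x)\}$ the convex conjugate. (P-ADMM): minimize $f(x)+g(y)$ over $x\in\mathbb{R}^p,y\in\mathbb{R}^q$ subject to $Ax+By=c$; its optimal value is $p^\star\in[-\infty,\infty]$. It is feasible if some $x\in\mathrm{dom} f$, $y\in\mathrm{dom} g$ satisfy $Ax+By=c$; $p^\star=\infty$ if it is infeasible. A solution of (P-ADMM) is a feasible point attaining $p^\star$. (D-ADMM): maximize $-f^*(-A^T\nu)-g^*(-B^T\nu)-c^T\nu$ over $\nu\in\mathbb{R}^n$; its optimal value is $d^\star\in[-\infty,\infty]$ ($d^\star=-\infty$ if infeasible). ADMM, with arbitrary starting $y^0\in\mathbb{R}^q$, $\nu^0\in\mathbb{R}^n$, is, for $k=0,1,\dots$: $x^{k+1}\in\arg\min_{x}\{f(x)+\langle\nu^k,Ax+By^k-c\rangle+\frac{1}{2\gamma}\|Ax+By^k-c\|^2\}$, $y^{k+1}\in\arg\min_{y}\{g(y)+\langle\nu^k,Ax^{k+1}+By-c\rangle+\frac{1}{2\gamma}\|Ax^{k+1}+By-c\|^2\}$, $\nu^{k+1}=\nu^k+\frac1\gamma(Ax^{k+1}+By^{k+1}-c)$. (The relative-interior conditions ensure that the argmins are nonempty; any selection of minimizers is allowed.) *)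

theory Defs
  imports "HOL-Analysis.Analysis"
begin

text \<open>
  Functions with values in \<open>\<real> \<union> {\<infinity>}\<close> are modelled as \<^typ>\<open>ereal\<close>-valued functions that never take the
  value \<open>-\<infinity>\<close>; this is part of \<open>proper_fun\<close> below.  \<open>epi\<close> is the counterpart of the library's
  \<open>epigraph\<close>, which is restricted to real-valued functions.
\<close>

definition epi :: "('a \<Rightarrow> ereal) \<Rightarrow> ('a \<times> real) set" where
  "epi f = {(x, t). f x \<le> ereal t}"

definition closed_fun :: "('a::topological_space \<Rightarrow> ereal) \<Rightarrow> bool" where
  "closed_fun f \<longleftrightarrow> closed (epi f)"

definition convex_fun :: "('a::real_vector \<Rightarrow> ereal) \<Rightarrow> bool" where
  "convex_fun f \<longleftrightarrow> convex (epi f)"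

definition proper_fun :: "('a \<Rightarrow> ereal) \<Rightarrow> bool" where
  "proper_fun f \<longleftrightarrow> (\<forall>x. f x \<noteq> -\<infinity>) \<and> (\<exists>x. f x \<noteq> \<infinity>)"

definition eff_dom :: "('a \<Rightarrow> ereal) \<Rightarrow> 'a set" where
  "eff_dom f = {x. f x < \<infinity>}"

definition conjugate_fun :: "('a::real_inner \<Rightarrow> ereal) \<Rightarrow> 'a \<Rightarrow> ereal" where
  "conjugate_fun f \<nu> = (SUP x. ereal (\<nu> \<bullet> x) - f x)"

text \<open>
  The domains of \<open>f\<close> and \<open>g\<close> need not be imposed in the infimum: outside of them the objective is
  \<open>\<infinity>\<close>.  In particular the infimum is \<open>\<infinity>\<close> if the problem is infeasible, and dually for the supremum.
\<close>

definition primal_value ::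
  "(real^'p \<Rightarrow> ereal) \<Rightarrow> (real^'q \<Rightarrow> ereal) \<Rightarrow> real^'p^'n \<Rightarrow> real^'q^'n \<Rightarrow> real^'n \<Rightarrow> ereal" where
  "primal_value f g A B c = (INF (x, y) \<in> {(x, y). A *v x + B *v y = c}. f x + g y)"

definition primal_feasible_point ::
  "(real^'p \<Rightarrow> ereal) \<Rightarrow> (real^'q \<Rightarrow> ereal) \<Rightarrow> real^'p^'n \<Rightarrow> real^'q^'n \<Rightarrow> real^'n
    \<Rightarrow> real^'p \<Rightarrow> real^'q \<Rightarrow> bool" where
  "primal_feasible_point f g A B c x y \<longleftrightarrow>
     x \<in> eff_dom f \<and> y \<in> eff_dom g \<and> A *v x + B *v y = c"

definition primal_feasible ::
  "(real^'p \<Rightarrow> ereal) \<Rightarrow> (real^'q \<Rightarrow> ereal) \<Rightarrow> real^'p^'n \<Rightarrow> real^'q^'n \<Rightarrow> real^'n \<Rightarrow> bool" where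
  "primal_feasible f g A B c \<longleftrightarrow> (\<exists>x y. primal_feasible_point f g A B c x y)"

definition primal_solution ::
  "(real^'p \<Rightarrow> ereal) \<Rightarrow> (real^'q \<Rightarrow> ereal) \<Rightarrow> real^'p^'n \<Rightarrow> real^'q^'n \<Rightarrow> real^'n
    \<Rightarrow> real^'p \<Rightarrow> real^'q \<Rightarrow> bool" where
  "primal_solution f g A B c x y \<longleftrightarrow>
     primal_feasible_point f g A B c x y \<and> f x + g y = primal_value f g A B c"

definition dual_value ::
  "(real^'p \<Rightarrow> ereal) \<Rightarrow> (real^'q \<Rightarrow> ereal) \<Rightarrow> real^'p^'n \<Rightarrow> real^'q^'n \<Rightarrow> real^'n \<Rightarrow> ereal" where
  "dual_value f g A B c =
     (SUP \<nu>. - conjugate_fun f (- (transpose A *v \<nu>)) - conjugate_fun g (- (transpose B *v \<nu>))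
             - ereal (c \<bullet> \<nu>))"

text \<open>
  \<open>y 0\<close> and \<open>\<nu> 0\<close> are the arbitrary starting points; \<open>x 0\<close> is unconstrained and plays no role.
\<close>

definition admm_sequence ::
  "(real^'p \<Rightarrow> ereal) \<Rightarrow> (real^'q \<Rightarrow> ereal) \<Rightarrow> real^'p^'n \<Rightarrow> real^'q^'n \<Rightarrow> real^'n \<Rightarrow> real
    \<Rightarrow> (nat \<Rightarrow> real^'p) \<Rightarrow> (nat \<Rightarrow> real^'q) \<Rightarrow> (nat \<Rightarrow> real^'n) \<Rightarrow> bool" where
  "admm_sequence f g A B c \<gamma> x y \<nu> \<longleftrightarrow>
     (\<forall>k. is_arg_min
            (\<lambda>u. f u + ereal (\<nu> k \<bullet> (A *v u + B *v y k - c))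
                     + ereal (1 / (2 * \<gamma>) * (norm (A *v u + B *v y k - c))\<^sup>2))
            (\<lambda>_. True) (x (Suc k))
        \<and> is_arg_min
            (\<lambda>w. g w + ereal (\<nu> k \<bullet> (A *v x (Suc k) + B *v w - c))
                     + ereal (1 / (2 * \<gamma>) * (norm (A *v x (Suc k) + B *v w - c))\<^sup>2))
            (\<lambda>_. True) (y (Suc k))
        \<and> \<nu> (Suc k) = \<nu> k + (1 / \<gamma>) *\<^sub>R (A *v x (Suc k) + B *v y (Suc k) - c))"

end

theory Submission
  imports Defs
begin

text \<open>
  The scheme is a Douglas--Rachford iteration on the dual.  With
  \<open>a\<^sup>k = A x\<^sup>k / \<gamma>\<close>, \<open>b\<^sup>k = (B y\<^sup>k - c) / \<gamma>\<close> and \<open>z\<^sup>k = \<nu>\<^sup>k - b\<^sup>k\<close>, the step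
  \<open>s\<^sup>k = z\<^bsup>k+1\<^esup> - z\<^sup>k\<close> equals \<open>a\<^bsup>k+1\<^esup> + b\<^sup>k\<close>, and monotonicity of the subdifferentials of
  \<open>f\<close> and \<open>g\<close> makes \<open>z\<^sup>k \<mapsto> z\<^bsup>k+1\<^esup>\<close> firmly nonexpansive along the orbit from \<open>k = 1\<close> on.

  The heart of the matter is that the residual \<open>\<gamma> (a\<^sup>k + b\<^sup>k)\<close> vanishes even when the dual is
  infeasible, in which case \<open>s\<^sup>k\<close> itself need not tend to zero.  Firm nonexpansiveness
  makes \<open>norm s\<^sup>k\<close> decrease to a limit \<open>\<ell>\<close>, which the drift of the orbit controls:
  \<open>m \<ell> \<le> norm (z\<^bsup>m+1\<^esup> - z\<^sup>1)\<close> (\<open>rate_le_drift\<close>).  The multipliers produced by the \<open>x\<close>-steps,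
  \<open>\<lambda>\<^bsup>k+1\<^esup> = \<nu>\<^sup>k + s\<^sup>k\<close>, and those produced by the \<open>y\<close>-steps, \<open>\<nu>\<^bsup>k+1\<^esup>\<close>, lie in the domains of the two
  dual functions \<open>f\<^sup>*(-A\<^sup>T\<cdot>)\<close> and \<open>g\<^sup>*(-B\<^sup>T\<cdot>)\<close>.  Fix one multiplier
  of each kind and let \<open>w\<close> be their difference.  After a translation by \<open>w\<close> the dual becomes
  feasible, and a feasible primal-dual pair with a finite duality gap, optimal or not, allows
  a drift of at most order \<open>\<surd>m\<close>.  Undoing the translation costs at most \<open>norm w\<close> per step, so
  \<open>\<ell> \<le> norm w\<close> (\<open>rate_le_gap\<close>).  Now apply this to \<open>\<lambda>\<^bsup>k+1\<^esup>\<close> and \<open>\<nu>\<^bsup>k+1\<^esup>\<close>, whose difference is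
  \<open>b\<^sup>k - b\<^bsup>k+1\<^esup>\<close>.  Since \<open>s\<^sup>k\<close> is the sum of the scaled residual and of \<open>b\<^sup>k - b\<^bsup>k+1\<^esup>\<close>, two vectors at a
  nonobtuse angle, the square of the scaled residual is at most \<open>norm s\<^sup>k\<close> squared minus \<open>\<ell>\<close>
  squared, and this tends to zero (\<open>residual_tendsto\<close>).

  For the objective, a quadratic energy relative to a feasible point decreases in every step by at least
  the excess of the current objective value over the value at that point
  (\<open>energy_decrease\<close>).  Telescoping bounds the averages and the limit inferior from
  above by \<open>p\<^sup>\<star>\<close>.  From below, weak duality bounds each objective value by a dual value
  minus the inner product of the multiplier with the residual, and the residual vanishes; strong
  duality closes the gap.  Finally, by lower semicontinuity a limit of \<open>(x\<^sup>k, y\<^sup>k)\<close> would be feasible with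
  value at most \<open>p\<^sup>\<star>\<close>, hence a solution.
\<close>

section \<open>Estimates for one Douglas--Rachford step\<close>

text \<open>
  The Lyapunov estimate behind everything else.  Here \<open>\<delta> - \<beta>\<close> is the difference of two states \<open>z\<close>
  before the step, \<open>\<delta> + \<alpha>\<close> their difference after it and \<open>\<alpha> + \<beta>\<close> the difference of the two
  displacements.  Exact monotonicity is the case \<open>C1 = C2 = 0\<close>, \<open>w = 0\<close>, which is firm
  nonexpansiveness; the slacks \<open>C1\<close>, \<open>C2\<close> admit a comparison point that is only
  approximately optimal, and \<open>w\<close> one that is dual feasible only after a translation.
\<close>
lemma shifted_step:
  fixes \<delta> \<alpha> \<beta> w :: "'v::real_inner"
  assumes "\<delta> \<bullet> \<beta> \<le> C2" and "(\<delta> + \<alpha> + \<beta> - w) \<bullet> \<alpha> \<le> C1"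
  shows "(norm (\<delta> + \<alpha>))\<^sup>2 + (norm (\<alpha> + \<beta>))\<^sup>2
    \<le> (norm (\<delta> - \<beta>))\<^sup>2 + 2 * C1 + 2 * C2 + 2 * (w \<bullet> \<alpha>)"
  using assms by (simp add: power2_norm_eq_inner inner_simps inner_commute)

text \<open>
  In the shifted estimate the term linear in \<open>w\<close> splits into \<open>w \<bullet> (\<alpha> + \<beta>)\<close>, which the displacement
  absorbs by completing the square, and \<open>- (w \<bullet> \<beta>)\<close>, where \<open>norm \<beta>\<close> is at most the square root
  below.  Together they complete the square of the right-hand side.
\<close>
lemma drift_step:
  fixes \<delta> \<alpha> \<beta> w :: "'v::real_inner"
  assumes b: "\<delta> \<bullet> \<beta> \<le> C2" and a: "(\<delta> + \<alpha> + \<beta> - w) \<bullet> \<alpha> \<le> C1"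
    and C: "0 \<le> C1" "0 \<le> C2"
  shows "norm (\<delta> + \<alpha>) \<le> norm w + sqrt ((norm (\<delta> - \<beta>))\<^sup>2 + (2 * C1 + 2 * C2))"
proof -
  define R where "R = sqrt ((norm (\<delta> - \<beta>))\<^sup>2 + (2 * C1 + 2 * C2))"
  have R2: "R\<^sup>2 = (norm (\<delta> - \<beta>))\<^sup>2 + (2 * C1 + 2 * C2)" and R0: "0 \<le> R"
    using C by (auto simp: R_def)
  have "(norm \<beta>)\<^sup>2 \<le> (norm (\<delta> - \<beta>))\<^sup>2 + 2 * C2"
    using b inner_ge_zero[of \<delta>] by (simp add: power2_norm_eq_inner inner_simps inner_commute)
  then have "(norm \<beta>)\<^sup>2 \<le> R\<^sup>2" using C R2 by simp
  then have \<beta>: "norm \<beta> \<le> R" using R0 by (rule power2_le_imp_le)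
  have "- (w \<bullet> \<beta>) \<le> norm w * norm \<beta>"
    using norm_cauchy_schwarz[of w "- \<beta>"] by simp
  also have "\<dots> \<le> norm w * R" using \<beta> by (simp add: mult_left_mono)
  finally have wb: "- (w \<bullet> \<beta>) \<le> norm w * R" .
  have "2 * (w \<bullet> \<alpha>) - (norm (\<alpha> + \<beta>))\<^sup>2 = (norm w)\<^sup>2 - (norm (\<alpha> + \<beta> - w))\<^sup>2 - 2 * (w \<bullet> \<beta>)"
    by (simp add: power2_norm_eq_inner inner_simps inner_commute)
  then have "2 * (w \<bullet> \<alpha>) - (norm (\<alpha> + \<beta>))\<^sup>2 \<le> (norm w)\<^sup>2 + 2 * (norm w * R)"
    using wb zero_le_power2[of "norm (\<alpha> + \<beta> - w)"] by linarith
  then have "(norm (\<delta> + \<alpha>))\<^sup>2 \<le> (norm w + R)\<^sup>2"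
    using shifted_step[OF b a] R2 by (simp add: power2_sum)
  then show ?thesis unfolding R_def[symmetric]
    by (rule power2_le_imp_le) (use R0 in simp)
qed

text \<open>
  The linear growth has slope exactly \<open>d\<close>: the slack \<open>C\<close> contributes only to order \<open>\<surd>m\<close> and so
  disappears in the average drift.
\<close>
lemma drift_recursion:
  fixes D :: "nat \<Rightarrow> real"
  assumes step: "\<And>k. D (Suc k) \<le> d + sqrt ((D k)\<^sup>2 + C)"
    and nonneg: "\<And>k. 0 \<le> D k" "0 \<le> d" "0 \<le> C"
  shows "D m \<le> real m * d + sqrt ((D 0)\<^sup>2 + real m * C)"
proof (induction m)
  case (Suc m)
  define S where "S = sqrt ((D 0)\<^sup>2 + real m * C)"
  define R where "R = sqrt ((D 0)\<^sup>2 + real (Suc m) * C)"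
  have S2: "S\<^sup>2 = (D 0)\<^sup>2 + real m * C" and R2: "R\<^sup>2 = S\<^sup>2 + C"
    using nonneg(3) by (auto simp: S_def R_def algebra_simps)
  have SR: "0 \<le> S" "S \<le> R" using nonneg(3) by (auto simp: S_def R_def mult_right_mono)
  have "(D m)\<^sup>2 + C \<le> (real m * d + S)\<^sup>2 + C"
    using Suc nonneg(1)[of m] by (simp add: S_def power_mono)
  also have "\<dots> \<le> (real m * d + R)\<^sup>2"
    using R2 SR nonneg(2) by (simp add: power2_sum mult_left_mono)
  finally have "sqrt ((D m)\<^sup>2 + C) \<le> real m * d + R"
    by (rule real_le_lsqrt[rotated]) (use SR nonneg(2) in simp)
  then show ?case using step[of m] by (simp add: R_def algebra_simps)
qed (use nonneg in simp)

section \<open>Orbits of the dual splitting\<close>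

text \<open>
  Here \<open>n k\<close> and \<open>n k + a k + b k\<close> are the multipliers of the two half steps, with \<open>- b k\<close> and
  \<open>- a k\<close> as subgradients of the respective dual functions up to the scaling by \<open>\<gamma>\<close>;
  \<open>a\<close> runs one step ahead, so that \<open>n k\<close>, \<open>b k\<close> and \<open>a k\<close> belong to the same displacement.  The assumptions \<open>gap_b\<close> and
  \<open>gap_a\<close> encode primal feasibility: the images of a feasible point are \<open>abar\<close> and \<open>- abar\<close>, and
  the constants are scaled Fenchel--Young gaps of that point against a fixed multiplier.
\<close>
locale splitting_orbit =
  fixes n a b :: "nat \<Rightarrow> 'v::real_inner" and abar :: 'v
  assumes n_Suc: "n (Suc k) = n k + a k + b (Suc k)"
    and mono_b: "(n i - n j) \<bullet> (b i - b j) \<le> 0"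
    and mono_a: "((n i + a i + b i) - (n j + a j + b j)) \<bullet> (a i - a j) \<le> 0"
    and gap_b: "\<exists>C. \<forall>i. (n i - n j) \<bullet> (b i + abar) \<le> C"
    and gap_a: "\<exists>C. \<forall>i. ((n i + a i + b i) - (n j + a j + b j)) \<bullet> (a i - abar) \<le> C"
begin

definition z where "z k = n k - b k"
definition s where "s k = a k + b k"

lemma z_Suc: "z (Suc k) = n k + a k"
  by (simp add: z_def n_Suc)

lemma z_step: "z (Suc k) - z k = s k"
  unfolding z_Suc s_def by (simp add: z_def)

lemma firmly_nonexpansive:
  "(norm (z (Suc i) - z (Suc j)))\<^sup>2 + (norm (s i - s j))\<^sup>2 \<le> (norm (z i - z j))\<^sup>2"
  using shifted_step[of "n i - n j" "b i - b j" 0 "a i - a j" 0 0] mono_b[of i j] mono_a[of i j]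
  unfolding z_Suc s_def by (simp add: z_def algebra_simps)

lemma s_decreasing: "(norm (s (Suc k)))\<^sup>2 + (norm (s (Suc k) - s k))\<^sup>2 \<le> (norm (s k))\<^sup>2"
  using firmly_nonexpansive[of "Suc k" k] by (simp add: z_step)

text \<open>
  Nonexpansiveness holds only between members of the orbit, so the orbit is compared with its own shift.
\<close>
lemma orbit_nonexpansive: "norm (z (k + m) - z k) \<le> norm (z m - z 0)"
proof (induction k)
  case (Suc k)
  have "(norm (z (Suc (k + m)) - z (Suc k)))\<^sup>2 \<le> (norm (z (k + m) - z k))\<^sup>2"
    using firmly_nonexpansive[of "k + m" k] zero_le_power2[of "norm (s (k + m) - s k)"] by linarith
  then have "norm (z (Suc (k + m)) - z (Suc k)) \<le> norm (z (k + m) - z k)"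
    by (rule power2_le_imp_le) simp
  then show ?case using Suc by simp
qed simp

text \<open>
  The norm of the minimal displacement vector of the iteration; nonzero only if the dual is strongly infeasible.
\<close>
definition rate where "rate = lim (\<lambda>k. norm (s k))"

lemma s_norm_tendsto: "(\<lambda>k. norm (s k)) \<longlonglongrightarrow> rate"
proof -
  have "norm (s (Suc k)) \<le> norm (s k)" for k
    by (rule power2_le_imp_le)
      (use s_decreasing[of k] zero_le_power2[of "norm (s (Suc k) - s k)"] in linarith, simp)
  then have "decseq (\<lambda>k. norm (s k))" by (simp add: decseq_Suc_iff)
  then obtain L where "(\<lambda>k. norm (s k)) \<longlonglongrightarrow> L"
    using decseq_convergent[of "\<lambda>k. norm (s k)" 0] by auto
  then show ?thesis by (simp add: rate_def limI)
qed

lemma rate_nonneg: "0 \<le> rate"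
  by (rule LIMSEQ_le_const[OF s_norm_tendsto]) simp

text \<open>
  Firm nonexpansiveness bounds the change of the displacement by the decrease of its squared norm.
\<close>
lemma s_diff_tendsto: "(\<lambda>k. s (Suc k) - s k) \<longlonglongrightarrow> 0"
proof -
  have "(\<lambda>k. (norm (s k))\<^sup>2 - (norm (s (Suc k)))\<^sup>2) \<longlonglongrightarrow> rate\<^sup>2 - rate\<^sup>2"
    by (intro tendsto_intros s_norm_tendsto LIMSEQ_Suc)
  then have "(\<lambda>k. (norm (s (Suc k) - s k))\<^sup>2) \<longlonglongrightarrow> 0"
    by (intro tendsto_sandwich[where f="\<lambda>_. 0" and g="\<lambda>k. (norm (s (Suc k) - s k))\<^sup>2"])
      (use s_decreasing in \<open>auto intro!: always_eventually simp: le_diff_eq add.commute\<close>)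
  then have "(\<lambda>k. sqrt ((norm (s (Suc k) - s k))\<^sup>2)) \<longlonglongrightarrow> sqrt 0"
    by (rule tendsto_real_sqrt)
  then show ?thesis by (simp add: tendsto_norm_zero_iff)
qed

text \<open>
  Late in the orbit consecutive displacements agree, so \<open>m\<close> steps move \<open>z\<close> by about \<open>m\<close> times one step.
\<close>
lemma displacement_tendsto: "(\<lambda>k. (z (k + m) - z k) - real m *\<^sub>R s k) \<longlonglongrightarrow> 0"
proof (induction m)
  case (Suc m)
  have shift: "(\<lambda>k. s (k + m) - s k) \<longlonglongrightarrow> 0" for m
  proof (induction m)
    case (Suc m)
    have "(\<lambda>k. s (Suc (k + m)) - s (k + m)) \<longlonglongrightarrow> 0"
      using LIMSEQ_ignore_initial_segment[OF s_diff_tendsto, of m] by simp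
    from tendsto_add[OF this Suc] show ?case by simp
  qed simp
  have eq: "(z (k + Suc m) - z k) - real (Suc m) *\<^sub>R s k
      = ((z (k + m) - z k) - real m *\<^sub>R s k) + (s (k + m) - s k)" for k
    using z_step[of "k + m"] by (simp add: algebra_simps)
  show ?case using tendsto_add[OF Suc shift[of m]] by (simp only: eq add_0_left)
qed simp

text \<open>
  By nonexpansiveness the first \<open>m\<close> steps move at least as far as any \<open>m\<close> later ones, which move about
  \<open>m * rate\<close>.
\<close>
lemma rate_le_drift: "real m * rate \<le> norm (z m - z 0)"
proof (rule LIMSEQ_le)
  show "(\<lambda>k. real m * norm (s k)) \<longlonglongrightarrow> real m * rate"
    by (intro tendsto_intros s_norm_tendsto)
  show "(\<lambda>k. norm (z m - z 0) + norm ((z (k + m) - z k) - real m *\<^sub>R s k)) \<longlonglongrightarrow> norm (z m - z 0)"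
    using tendsto_add[OF tendsto_const tendsto_norm_zero[OF displacement_tendsto]] by force
  have "real m * norm (s k) \<le> norm (z m - z 0) + norm ((z (k + m) - z k) - real m *\<^sub>R s k)" for k
    using norm_triangle_ineq4[of "z (k + m) - z k" "(z (k + m) - z k) - real m *\<^sub>R s k"]
      orbit_nonexpansive[of k m] by simp
  then show "\<exists>N. \<forall>k\<ge>N. real m * norm (s k)
      \<le> norm (z m - z 0) + norm ((z (k + m) - z k) - real m *\<^sub>R s k)" by blast
qed

text \<open>
  The set of differences of multipliers of the two kinds has distance at least \<open>rate\<close> from \<open>0\<close>.  The state
  \<open>zbar\<close> built from \<open>n j\<close> and the feasible point is an approximate fixed point once the translation
  by \<open>w\<close> is taken into account, so \<open>drift_step\<close> limits the drift to \<open>m * norm w + O(\<surd>m)\<close>.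
\<close>
lemma rate_le_gap: "rate \<le> norm ((n i + a i + b i) - n j)"
proof -
  define w where "w = (n i + a i + b i) - n j"
  define zbar where "zbar = n j + abar"
  obtain C1 where C1: "\<And>k. ((n k + a k + b k) - (n i + a i + b i)) \<bullet> (a k - abar) \<le> C1"
    using gap_a[of i] by auto
  obtain C2 where C2: "\<And>k. (n k - n j) \<bullet> (b k + abar) \<le> C2"
    using gap_b[of j] by auto
  have C0: "0 \<le> C1" "0 \<le> C2" using C1[of i] C2[of j] by auto
  define C where "C = 2 * C1 + 2 * C2"
  define D where "D k = norm (z k - zbar)" for k
  have step: "D (Suc k) \<le> norm w + sqrt ((D k)\<^sup>2 + C)" for k
  proof -
    have "z (Suc k) - zbar = (n k - n j) + (a k - abar)"
      by (simp add: z_Suc zbar_def)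
    moreover have "z k - zbar = (n k - n j) - (b k + abar)"
      by (simp add: z_def zbar_def)
    moreover have "(n k - n j) + (a k - abar) + (b k + abar) - w = (n k + a k + b k) - (n i + a i + b i)"
      by (simp add: w_def)
    ultimately show ?thesis unfolding D_def C_def
      using drift_step[of "n k - n j" "b k + abar" C2 "a k - abar" w C1, OF C2 _ C0] C1[of k]
      by (simp only:)
  qed
  have D: "D m \<le> real m * norm w + sqrt ((D 0)\<^sup>2 + real m * C)" for m
    by (rule drift_recursion[where D = D, OF step]) (use C0 in \<open>auto simp: D_def C_def\<close>)
  have bound: "rate - norm w \<le> sqrt ((D 0)\<^sup>2 / (real m)\<^sup>2 + C / real m) + D 0 / real m" if "m > 0" for m
  proof -
    have "real m * rate \<le> D m + D 0"
      using rate_le_drift[of m] norm_triangle_ineq4[of "z m - zbar" "z 0 - zbar"] by (simp add: D_def)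
    then have "real m * (rate - norm w) \<le> sqrt ((D 0)\<^sup>2 + real m * C) + D 0"
      using D[of m] by (simp add: algebra_simps)
    then have "rate - norm w \<le> (sqrt ((D 0)\<^sup>2 + real m * C) + D 0) / real m"
      using that by (simp add: field_simps)
    also have "\<dots> = sqrt (((D 0)\<^sup>2 + real m * C) / (real m)\<^sup>2) + D 0 / real m"
      using that by (simp add: real_sqrt_divide field_simps)
    also have "((D 0)\<^sup>2 + real m * C) / (real m)\<^sup>2 = (D 0)\<^sup>2 / (real m)\<^sup>2 + C / real m"
      using that by (simp add: field_simps power2_eq_square)
    finally show ?thesis .
  qed
  have "rate - norm w \<le> 0"
  proof (rule LIMSEQ_le_const)
    have inv: "(\<lambda>m. 1 / real m) \<longlonglongrightarrow> 0" by (rule lim_1_over_n)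
    have "(\<lambda>m. sqrt ((D 0)\<^sup>2 * (1 / real m)\<^sup>2 + C * (1 / real m)) + D 0 * (1 / real m))
        \<longlonglongrightarrow> sqrt ((D 0)\<^sup>2 * 0\<^sup>2 + C * 0) + D 0 * 0"
      by (intro tendsto_intros inv)
    then show "(\<lambda>m. sqrt ((D 0)\<^sup>2 / (real m)\<^sup>2 + C / real m) + D 0 / real m) \<longlonglongrightarrow> 0"
      by (simp add: power_divide)
    show "\<exists>N. \<forall>m\<ge>N. rate - norm w \<le> sqrt ((D 0)\<^sup>2 / (real m)\<^sup>2 + C / real m) + D 0 / real m"
      using bound by (intro exI[of _ 1]) simp
  qed
  then show ?thesis by (simp add: w_def)
qed

text \<open>
  The displacement \<open>s k\<close> is the residual \<open>a k + b (Suc k)\<close> minus \<open>b (Suc k) - b k\<close>, and these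
  two vectors form a nonacute angle by monotonicity.  The second one is, up to sign, a difference of
  multipliers and therefore already accounts for the whole limit of \<open>norm (s k)\<close>.
\<close>
lemma residual_tendsto: "(\<lambda>k. a k + b (Suc k)) \<longlonglongrightarrow> 0"
proof -
  have bound: "(norm (a k + b (Suc k)))\<^sup>2 \<le> (norm (s k))\<^sup>2 - rate\<^sup>2" for k
  proof -
    have "(n k + a k + b k) - n (Suc k) = - (b (Suc k) - b k)" by (simp add: n_Suc)
    then have "rate \<le> norm (b (Suc k) - b k)"
      using rate_le_gap[of k "Suc k"] by (metis norm_minus_cancel)
    then have "rate\<^sup>2 \<le> (norm (b (Suc k) - b k))\<^sup>2" using rate_nonneg by (rule power_mono)
    moreover have "(a k + b (Suc k)) \<bullet> (b (Suc k) - b k) \<le> 0"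
      using mono_b[of "Suc k" k] by (simp add: n_Suc algebra_simps)
    then have "(norm (a k + b (Suc k)))\<^sup>2 + (norm (b (Suc k) - b k))\<^sup>2 \<le> (norm (s k))\<^sup>2"
      by (simp add: s_def power2_norm_eq_inner inner_simps inner_commute)
    ultimately show ?thesis by linarith
  qed
  have "(\<lambda>k. (norm (s k))\<^sup>2 - rate\<^sup>2) \<longlonglongrightarrow> rate\<^sup>2 - rate\<^sup>2"
    by (intro tendsto_intros s_norm_tendsto)
  then have "(\<lambda>k. (norm (a k + b (Suc k)))\<^sup>2) \<longlonglongrightarrow> 0"
    by (intro tendsto_sandwich[where f="\<lambda>_. 0" and g="\<lambda>k. (norm (a k + b (Suc k)))\<^sup>2"])
      (use bound in \<open>auto intro!: always_eventually\<close>)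
  then have "(\<lambda>k. sqrt ((norm (a k + b (Suc k)))\<^sup>2)) \<longlonglongrightarrow> sqrt 0"
    by (rule tendsto_real_sqrt)
  then show ?thesis by (simp add: tendsto_norm_zero_iff)
qed

end

section \<open>Optimality conditions for the two half steps\<close>

lemma convex_fun_segment:
  assumes "convex_fun f" and "f u = ereal p" and "f v = ereal q" and "0 \<le> t" and "t \<le> 1"
  shows "f ((1 - t) *\<^sub>R u + t *\<^sub>R v) \<le> ereal ((1 - t) * p + t * q)"
proof -
  have "(1 - t) *\<^sub>R (u, p) + t *\<^sub>R (v, q) \<in> epi f"
    by (rule convexD) (use assms in \<open>auto simp: convex_fun_def epi_def\<close>)
  then show ?thesis by (simp add: epi_def)
qed

text \<open>
  First-order optimality without subdifferential calculus: moving from the minimizer a fraction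
  \<open>t\<close> of the way towards \<open>u\<close> changes \<open>f\<close> by at most \<open>t * (q - p)\<close> and the smooth part by its derivative
  plus \<open>O(t\<^sup>2)\<close>.  Divide by \<open>t\<close> and let \<open>t\<close> tend to \<open>0\<close>.
\<close>
lemma penalized_argmin_subgradient:
  fixes f :: "'a::real_vector \<Rightarrow> ereal" and M :: "'a \<Rightarrow> 'v::real_inner"
  assumes f: "proper_fun f" "convex_fun f" and M: "linear M" and "\<gamma> > 0"
    and min: "is_arg_min (\<lambda>u. f u + ereal (\<mu> \<bullet> (M u + e)) + ereal (1 / (2 * \<gamma>) * (norm (M u + e))\<^sup>2))
      (\<lambda>_. True) u0"
  obtains p where "f u0 = ereal p"
    and "\<And>u q. f u = ereal q \<Longrightarrow> p \<le> q + (\<mu> + (1 / \<gamma>) *\<^sub>R (M u0 + e)) \<bullet> (M u - M u0)"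
proof -
  define h where "h v = \<mu> \<bullet> (v + e) + 1 / (2 * \<gamma>) * (norm (v + e))\<^sup>2" for v
  have "f u0 + ereal (\<mu> \<bullet> (M u0 + e)) + ereal (1 / (2 * \<gamma>) * (norm (M u0 + e))\<^sup>2)
      \<le> f u + ereal (\<mu> \<bullet> (M u + e)) + ereal (1 / (2 * \<gamma>) * (norm (M u + e))\<^sup>2)" for u
    using min by (auto simp: is_arg_min_def not_less)
  then have le: "f u0 + ereal (h (M u0)) \<le> f u + ereal (h (M u))" for u
    by (simp add: h_def add.assoc)
  obtain u1 q1 where "f u1 = ereal q1"
    using f(1) unfolding proper_fun_def by (metis ereal_cases)
  then have "f u0 \<noteq> \<infinity>" using le[of u1] by auto
  then obtain p where p: "f u0 = ereal p"
    using f(1) unfolding proper_fun_def by (metis ereal_cases)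
  have "p \<le> q + (\<mu> + (1 / \<gamma>) *\<^sub>R (M u0 + e)) \<bullet> (M u - M u0)" if q: "f u = ereal q" for u q
  proof -
    define d where "d = M u - M u0"
    define G where "G = q - p + (\<mu> + (1 / \<gamma>) *\<^sub>R (M u0 + e)) \<bullet> d"
    have pos: "0 \<le> G + t * (1 / (2 * \<gamma>) * (norm d)\<^sup>2)" if t: "0 < t" "t \<le> 1" for t
    proof -
      have Mt: "M ((1 - t) *\<^sub>R u0 + t *\<^sub>R u) = M u0 + t *\<^sub>R d"
        using M by (simp add: linear_add linear_diff linear_scale d_def algebra_simps)
      have "f u0 + ereal (h (M u0)) \<le> f ((1 - t) *\<^sub>R u0 + t *\<^sub>R u) + ereal (h (M u0 + t *\<^sub>R d))"
        using le[of "(1 - t) *\<^sub>R u0 + t *\<^sub>R u"] Mt by simp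
      also have "\<dots> \<le> ereal ((1 - t) * p + t * q) + ereal (h (M u0 + t *\<^sub>R d))"
        by (intro add_right_mono convex_fun_segment[OF f(2) p q]) (use t in auto)
      finally have "p + h (M u0) \<le> (1 - t) * p + t * q + h (M u0 + t *\<^sub>R d)"
        by (simp add: p)
      moreover have "h (M u0 + t *\<^sub>R d) = h (M u0)
          + t * ((\<mu> + (1 / \<gamma>) *\<^sub>R (M u0 + e)) \<bullet> d) + t * (t * (1 / (2 * \<gamma>) * (norm d)\<^sup>2))"
        using \<open>\<gamma> > 0\<close>
        by (simp add: h_def power2_norm_eq_inner inner_simps inner_commute field_simps)
      ultimately have "0 \<le> t * (G + t * (1 / (2 * \<gamma>) * (norm d)\<^sup>2))"
        by (simp add: G_def algebra_simps)
      then show ?thesis using t by (simp add: zero_le_mult_iff)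
    qed
    have "0 \<le> G"
    proof (rule tendsto_lowerbound)
      have "((\<lambda>t. G + t * (1 / (2 * \<gamma>) * (norm d)\<^sup>2)) \<longlongrightarrow> G + 0 * (1 / (2 * \<gamma>) * (norm d)\<^sup>2)) (at_right 0)"
        by (intro tendsto_intros)
      then show "((\<lambda>t. G + t * (1 / (2 * \<gamma>) * (norm d)\<^sup>2)) \<longlongrightarrow> G) (at_right 0)" by simp
      show "\<forall>\<^sub>F t in at_right 0. 0 \<le> G + t * (1 / (2 * \<gamma>) * (norm d)\<^sup>2)"
        unfolding eventually_at_right_field using pos by (intro exI[of _ 1]) auto
    qed simp
    then show ?thesis by (simp add: G_def d_def)
  qed
  with p that show thesis by blast
qed

section \<open>The iteration in scaled coordinates\<close>

locale admm_run =
  fixes f :: "real^'p \<Rightarrow> ereal" and g :: "real^'q \<Rightarrow> ereal"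
    and A :: "real^'p^'n" and B :: "real^'q^'n" and c :: "real^'n" and \<gamma> :: real
    and x :: "nat \<Rightarrow> real^'p" and y :: "nat \<Rightarrow> real^'q" and \<nu> :: "nat \<Rightarrow> real^'n"
  assumes proper_f: "proper_fun f" and convex_f: "convex_fun f"
    and proper_g: "proper_fun g" and convex_g: "convex_fun g"
    and \<gamma>_pos: "\<gamma> > 0"
    and admm: "admm_sequence f g A B c \<gamma> x y \<nu>"
begin

text \<open>
  Scaling by \<open>1 / \<gamma>\<close> gives the multiplier update step length one.  The values
  \<open>\<phi> k\<close> and \<open>\<psi> k\<close> are meaningful for \<open>k \<ge> 1\<close> only: \<open>f (x 0)\<close> and \<open>g (y 0)\<close> may be infinite.
\<close>
definition a where "a u = (1 / \<gamma>) *\<^sub>R (A *v u)"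
definition b where "b w = (1 / \<gamma>) *\<^sub>R (B *v w - c)"
definition \<phi> where "\<phi> k = real_of_ereal (f (x k))"
definition \<psi> where "\<psi> k = real_of_ereal (g (y k))"

lemma residual_eq: "A *v u + B *v w - c = \<gamma> *\<^sub>R (a u + b w)"
  using \<gamma>_pos by (simp add: a_def b_def scaleR_add_right)

lemma \<nu>_Suc: "\<nu> (Suc k) = \<nu> k + a (x (Suc k)) + b (y (Suc k))"
  using admm \<gamma>_pos unfolding admm_sequence_def residual_eq by simp

text \<open>
  The multiplier is the one available after the \<open>x\<close>-step, formed with the old \<open>y k\<close>.
\<close>
lemma f_subgradient:
  "f (x (Suc k)) = ereal (\<phi> (Suc k))"
  "f u = ereal p \<Longrightarrow> \<phi> (Suc k) \<le> p + \<gamma> * ((\<nu> k + a (x (Suc k)) + b (y k)) \<bullet> (a u - a (x (Suc k))))"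
proof -
  have "is_arg_min (\<lambda>u. f u + ereal (\<nu> k \<bullet> (A *v u + (B *v y k - c)))
      + ereal (1 / (2 * \<gamma>) * (norm (A *v u + (B *v y k - c)))\<^sup>2)) (\<lambda>_. True) (x (Suc k))"
    using admm unfolding admm_sequence_def by (simp add: add_diff_eq)
  from penalized_argmin_subgradient[OF proper_f convex_f matrix_vector_mul_linear \<gamma>_pos this]
  obtain q where q: "f (x (Suc k)) = ereal q"
    and sub: "\<And>u p. f u = ereal p \<Longrightarrow> q \<le> p + (\<nu> k + (1 / \<gamma>) *\<^sub>R (A *v x (Suc k) + (B *v y k - c)))
      \<bullet> (A *v u - A *v x (Suc k))"
    by blast
  show "f (x (Suc k)) = ereal (\<phi> (Suc k))" by (simp add: q \<phi>_def)
  have "(1 / \<gamma>) *\<^sub>R (A *v x (Suc k) + (B *v y k - c)) = a (x (Suc k)) + b (y k)"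
    by (simp add: a_def b_def scaleR_add_right)
  moreover have "A *v u - A *v x (Suc k) = \<gamma> *\<^sub>R (a u - a (x (Suc k)))"
    using \<gamma>_pos by (simp add: a_def scaleR_diff_right)
  ultimately show "\<phi> (Suc k) \<le> p + \<gamma> * ((\<nu> k + a (x (Suc k)) + b (y k)) \<bullet> (a u - a (x (Suc k))))"
    if "f u = ereal p"
    using sub[OF that] q by (simp add: \<phi>_def add.assoc)
qed

lemma g_subgradient:
  "g (y (Suc k)) = ereal (\<psi> (Suc k))"
  "g w = ereal q \<Longrightarrow> \<psi> (Suc k) \<le> q + \<gamma> * (\<nu> (Suc k) \<bullet> (b w - b (y (Suc k))))"
proof -
  have comm: "A *v u + B *v w - c = B *v w + (A *v u - c)" for u w
    by (simp add: algebra_simps)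
  have "is_arg_min (\<lambda>w. g w + ereal (\<nu> k \<bullet> (B *v w + (A *v x (Suc k) - c)))
      + ereal (1 / (2 * \<gamma>) * (norm (B *v w + (A *v x (Suc k) - c)))\<^sup>2)) (\<lambda>_. True) (y (Suc k))"
    using admm unfolding admm_sequence_def by (simp only: comm)
  from penalized_argmin_subgradient[OF proper_g convex_g matrix_vector_mul_linear \<gamma>_pos this]
  obtain p where p: "g (y (Suc k)) = ereal p"
    and sub: "\<And>w q. g w = ereal q \<Longrightarrow> p \<le> q + (\<nu> k + (1 / \<gamma>) *\<^sub>R (B *v y (Suc k) + (A *v x (Suc k) - c)))
      \<bullet> (B *v w - B *v y (Suc k))"
    by blast
  show "g (y (Suc k)) = ereal (\<psi> (Suc k))" by (simp add: p \<psi>_def)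
  have "\<nu> k + (1 / \<gamma>) *\<^sub>R (B *v y (Suc k) + (A *v x (Suc k) - c)) = \<nu> (Suc k)"
    using admm unfolding admm_sequence_def by (simp add: algebra_simps)
  moreover have "B *v w - B *v y (Suc k) = \<gamma> *\<^sub>R (b w - b (y (Suc k)))"
    using \<gamma>_pos by (simp add: b_def algebra_simps)
  ultimately show "\<psi> (Suc k) \<le> q + \<gamma> * (\<nu> (Suc k) \<bullet> (b w - b (y (Suc k))))"
    if "g w = ereal q"
    using sub[OF that] p by (simp add: \<psi>_def)
qed

lemma feasible_finite:
  assumes "primal_feasible_point f g A B c u w"
  obtains p q where "f u = ereal p" and "g w = ereal q" and "b w = - a u"
proof -
  have "f u \<noteq> \<infinity>" "f u \<noteq> -\<infinity>" "g w \<noteq> \<infinity>" "g w \<noteq> -\<infinity>" "A *v u + B *v w - c = 0"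
    using assms proper_f proper_g
    by (auto simp: primal_feasible_point_def eff_dom_def proper_fun_def)
  then show thesis
    using that residual_eq[of u w] \<gamma>_pos by (metis ereal_cases eq_neg_iff_add_eq_0 add.commute scaleR_eq_0_iff less_irrefl)
qed

text \<open>
  The orbit starts at index \<open>1\<close>, since \<open>\<nu> 0\<close> is arbitrary and carries no subgradient of \<open>g\<close>.
\<close>
lemma primal_residual_tendsto:
  assumes "primal_feasible_point f g A B c u w"
  shows "(\<lambda>k. A *v x k + B *v y k - c) \<longlonglongrightarrow> 0"
proof -
  obtain p q where p: "f u = ereal p" and q: "g w = ereal q" and bw: "b w = - a u"
    using feasible_finite[OF assms] by blast
  interpret splitting_orbit "\<lambda>k. \<nu> (Suc k)" "\<lambda>k. a (x (Suc (Suc k)))" "\<lambda>k. b (y (Suc k))" "a u"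
  proof
    show "\<nu> (Suc (Suc k)) = \<nu> (Suc k) + a (x (Suc (Suc k))) + b (y (Suc (Suc k)))" for k
      by (rule \<nu>_Suc)
  next
    fix i j
    let ?l = "\<lambda>k. \<nu> (Suc k) + a (x (Suc (Suc k))) + b (y (Suc k))"
    let ?a = "\<lambda>k. a (x (Suc (Suc k)))" and ?b = "\<lambda>k. b (y (Suc k))"
    have "0 \<le> \<gamma> * (\<nu> (Suc i) \<bullet> (?b j - ?b i)) + \<gamma> * (\<nu> (Suc j) \<bullet> (?b i - ?b j))"
      using g_subgradient(2)[OF g_subgradient(1)[of j], of i]
        g_subgradient(2)[OF g_subgradient(1)[of i], of j] by linarith
    also have "\<dots> = \<gamma> * - ((\<nu> (Suc i) - \<nu> (Suc j)) \<bullet> (?b i - ?b j))"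
      by (simp add: inner_simps algebra_simps)
    finally show "(\<nu> (Suc i) - \<nu> (Suc j)) \<bullet> (?b i - ?b j) \<le> 0"
      using \<gamma>_pos by (simp only: zero_le_mult_iff) simp
    have "0 \<le> \<gamma> * (?l i \<bullet> (?a j - ?a i)) + \<gamma> * (?l j \<bullet> (?a i - ?a j))"
      using f_subgradient(2)[OF f_subgradient(1)[of "Suc j"], of "Suc i"]
        f_subgradient(2)[OF f_subgradient(1)[of "Suc i"], of "Suc j"] by linarith
    also have "\<dots> = \<gamma> * - ((?l i - ?l j) \<bullet> (?a i - ?a j))"
      by (simp add: inner_simps algebra_simps)
    finally show "(?l i - ?l j) \<bullet> (?a i - ?a j) \<le> 0"
      using \<gamma>_pos by (simp only: zero_le_mult_iff) simp
  next
    fix j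
    let ?l = "\<lambda>k. \<nu> (Suc k) + a (x (Suc (Suc k))) + b (y (Suc k))"
    let ?a = "\<lambda>k. a (x (Suc (Suc k)))" and ?b = "\<lambda>k. b (y (Suc k))"
    show "\<exists>C. \<forall>i. (\<nu> (Suc i) - \<nu> (Suc j)) \<bullet> (?b i + a u) \<le> C"
    proof (intro exI allI)
      fix i
      have "\<psi> (Suc j) - q \<le> \<gamma> * (\<nu> (Suc i) \<bullet> (b w - ?b i)) + \<gamma> * (\<nu> (Suc j) \<bullet> (?b i - ?b j))"
        using g_subgradient(2)[OF q, of i]
          g_subgradient(2)[OF g_subgradient(1)[of i], of j] by linarith
      also have "\<dots> = \<gamma> * (\<nu> (Suc j) \<bullet> (b w - ?b j)) - \<gamma> * ((\<nu> (Suc i) - \<nu> (Suc j)) \<bullet> (?b i + a u))"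
        by (simp add: bw inner_simps algebra_simps)
      finally have "\<gamma> * ((\<nu> (Suc i) - \<nu> (Suc j)) \<bullet> (?b i + a u))
          \<le> q - \<psi> (Suc j) + \<gamma> * (\<nu> (Suc j) \<bullet> (b w - ?b j))" by linarith
      then show "(\<nu> (Suc i) - \<nu> (Suc j)) \<bullet> (?b i + a u)
          \<le> (q - \<psi> (Suc j) + \<gamma> * (\<nu> (Suc j) \<bullet> (b w - ?b j))) / \<gamma>"
        using \<gamma>_pos by (simp add: pos_le_divide_eq mult.commute)
    qed
    show "\<exists>C. \<forall>i. (?l i - ?l j) \<bullet> (?a i - a u) \<le> C"
    proof (intro exI allI)
      fix i
      have "\<phi> (Suc (Suc j)) - p \<le> \<gamma> * (?l i \<bullet> (a u - ?a i)) + \<gamma> * (?l j \<bullet> (?a i - ?a j))"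
        using f_subgradient(2)[OF p, of "Suc i"]
          f_subgradient(2)[OF f_subgradient(1)[of "Suc i"], of "Suc j"] by linarith
      also have "\<dots> = \<gamma> * (?l j \<bullet> (a u - ?a j)) - \<gamma> * ((?l i - ?l j) \<bullet> (?a i - a u))"
        by (simp add: inner_simps algebra_simps)
      finally have "\<gamma> * ((?l i - ?l j) \<bullet> (?a i - a u))
          \<le> p - \<phi> (Suc (Suc j)) + \<gamma> * (?l j \<bullet> (a u - ?a j))" by linarith
      then show "(?l i - ?l j) \<bullet> (?a i - a u)
          \<le> (p - \<phi> (Suc (Suc j)) + \<gamma> * (?l j \<bullet> (a u - ?a j))) / \<gamma>"
        using \<gamma>_pos by (simp add: pos_le_divide_eq mult.commute)
    qed
  qed
  have "(\<lambda>k. a (x (Suc (Suc k))) + b (y (Suc (Suc k)))) \<longlonglongrightarrow> 0"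
    by (rule residual_tendsto)
  then have "(\<lambda>k. a (x k) + b (y k)) \<longlonglongrightarrow> 0"
    by (intro LIMSEQ_imp_Suc[where f = "\<lambda>k. a (x k) + b (y k)"]
        LIMSEQ_imp_Suc[where f = "\<lambda>k. a (x (Suc k)) + b (y (Suc k))"])
  then have "(\<lambda>k. \<gamma> *\<^sub>R (a (x k) + b (y k))) \<longlonglongrightarrow> \<gamma> *\<^sub>R 0"
    by (intro tendsto_intros)
  then show ?thesis by (simp add: residual_eq)
qed

end

section \<open>Objective values\<close>

lemma cesaro_mean:
  fixes X :: "nat \<Rightarrow> 'v::real_normed_vector"
  assumes "X \<longlonglongrightarrow> 0"
  shows "(\<lambda>k. (1 / real k) *\<^sub>R (\<Sum>i=1..k. X i)) \<longlonglongrightarrow> 0"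
proof (rule LIMSEQ_I)
  fix e :: real assume e: "e > 0"
  then obtain N where N: "\<And>k. k \<ge> N \<Longrightarrow> norm (X k) < e / 2"
    using LIMSEQ_D[OF assms, of "e / 2"] by auto
  define K where "K = (\<Sum>i<N. norm (X i))"
  have bound: "norm ((1 / real k) *\<^sub>R (\<Sum>i=1..k. X i)) \<le> e / 2 + K * (1 / real k)" if "k > 0" for k
  proof -
    have "norm (\<Sum>i=1..k. X i) \<le> (\<Sum>i=1..k. norm (X i))" by (rule norm_sum)
    also have "\<dots> \<le> (\<Sum>i=1..k. e / 2 + (if i < N then norm (X i) else 0))"
      using N e by (intro sum_mono) (auto simp: not_less less_imp_le)
    also have "\<dots> = real k * (e / 2) + (\<Sum>i \<in> {1..k} \<inter> {i. i < N}. norm (X i))"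
      by (simp add: sum.distrib sum.If_cases)
    also have "(\<Sum>i \<in> {1..k} \<inter> {i. i < N}. norm (X i)) \<le> K"
      unfolding K_def by (intro sum_mono2) auto
    finally show ?thesis using that by (simp add: field_simps)
  qed
  have "(\<lambda>k. K * (1 / real k)) \<longlonglongrightarrow> K * 0"
    by (intro tendsto_intros lim_1_over_n)
  then obtain M where M: "\<And>k. k \<ge> M \<Longrightarrow> K * (1 / real k) < e / 2"
    using e by (fastforce dest: order_tendstoD(2)[of _ _ _ "e / 2"] simp: eventually_sequentially)
  show "\<exists>no. \<forall>k\<ge>no. norm ((1 / real k) *\<^sub>R (\<Sum>i=1..k. X i) - 0) < e"
  proof (intro exI[of _ "max 1 M"] allI impI)
    fix k assume "k \<ge> max 1 M"
    then show "norm ((1 / real k) *\<^sub>R (\<Sum>i=1..k. X i) - 0) < e"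
      using add_strict_left_mono[OF M[of k], of "e / 2"] bound[of k] by (simp only: diff_zero) linarith
  qed
qed

context admm_run
begin

definition energy where
  "energy w k = \<gamma> / 2 * ((norm (\<nu> k))\<^sup>2 + (norm (b (y k) - b w))\<^sup>2)"

lemma energy_nonneg: "0 \<le> energy w k"
  using \<gamma>_pos by (simp add: energy_def)

text \<open>
  Adding the two subgradient inequalities at the feasible point leaves, after polarization, the
  energy difference minus a multiple of the squared displacement \<open>\<alpha> + \<beta>\<close>.  Unlike the residual
  estimate this also covers \<open>k = 0\<close>, because only subgradients at the new iterates enter.
\<close>
lemma energy_decrease:
  assumes p: "f u = ereal p" and q: "g w = ereal q" and bw: "b w = - a u"
  shows "\<phi> (Suc k) + \<psi> (Suc k) + energy w (Suc k) \<le> p + q + energy w k"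
proof -
  define n where "n = \<nu> k"
  define \<alpha> where "\<alpha> = a (x (Suc k)) - a u"
  define \<beta> where "\<beta> = b (y k) - b w"
  define \<beta>' where "\<beta>' = b (y (Suc k)) - b w"
  have n': "\<nu> (Suc k) = n + \<alpha> + \<beta>'"
    by (simp add: n_def \<nu>_Suc \<alpha>_def \<beta>'_def bw)
  have l: "\<nu> k + a (x (Suc k)) + b (y k) = n + \<alpha> + \<beta>"
    by (simp add: n_def \<alpha>_def \<beta>_def bw)
  have ua: "a u - a (x (Suc k)) = - \<alpha>" and wb: "b w - b (y (Suc k)) = - \<beta>'"
    by (simp_all add: \<alpha>_def \<beta>'_def)
  have "\<phi> (Suc k) + \<psi> (Suc k) \<le> p + q - \<gamma> * ((n + \<alpha> + \<beta>) \<bullet> \<alpha> + (n + \<alpha> + \<beta>') \<bullet> \<beta>')"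
    using f_subgradient(2)[OF p, of k] g_subgradient(2)[OF q, of k]
    unfolding l n' ua wb by (simp add: algebra_simps)
  also have "(n + \<alpha> + \<beta>) \<bullet> \<alpha> + (n + \<alpha> + \<beta>') \<bullet> \<beta>'
      = 1 / 2 * ((norm (n + \<alpha> + \<beta>'))\<^sup>2 + (norm \<beta>')\<^sup>2)
        - 1 / 2 * ((norm n)\<^sup>2 + (norm \<beta>)\<^sup>2) + 1 / 2 * (norm (\<alpha> + \<beta>))\<^sup>2"
    by (simp add: power2_norm_eq_inner inner_simps inner_commute field_simps)
  finally have "\<phi> (Suc k) + \<psi> (Suc k) + energy w (Suc k)
      \<le> p + q + energy w k - \<gamma> * (1 / 2 * (norm (\<alpha> + \<beta>))\<^sup>2)"
    unfolding energy_def n' n_def[symmetric] \<beta>_def[symmetric] \<beta>'_def[symmetric]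
    by (simp add: algebra_simps)
  moreover have "0 \<le> \<gamma> * (1 / 2 * (norm (\<alpha> + \<beta>))\<^sup>2)" using \<gamma>_pos by simp
  ultimately show ?thesis by linarith
qed

lemma objective_sum_le:
  assumes "f u = ereal p" and "g w = ereal q" and "b w = - a u"
  shows "(\<Sum>i=1..k. \<phi> i + \<psi> i) \<le> real k * (p + q) + energy w 0"
proof -
  have "(\<Sum>i=1..k. \<phi> i + \<psi> i) + energy w k \<le> real k * (p + q) + energy w 0"
  proof (induction k)
    case (Suc k)
    then show ?case using energy_decrease[OF assms, of k] by (simp add: algebra_simps)
  qed simp
  then show ?thesis using energy_nonneg[of w k] by linarith
qed

text \<open>
  Both sides vanish for \<open>k = 0\<close>, and the possibly infinite values at index \<open>0\<close> do not enter the sum.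
\<close>
lemma average_eq:
  "ereal (1 / real k) * (\<Sum>i=1..k. f (x i) + g (y i)) = ereal (1 / real k * (\<Sum>i=1..k. \<phi> i + \<psi> i))"
proof -
  have "f (x i) + g (y i) = ereal (\<phi> i + \<psi> i)" if "i \<in> {1..k}" for i
    using that f_subgradient(1)[of "i - 1"] g_subgradient(1)[of "i - 1"] by simp
  then have "(\<Sum>i=1..k. f (x i) + g (y i)) = ereal (\<Sum>i=1..k. \<phi> i + \<psi> i)"
    by simp
  then show ?thesis by simp
qed

lemma feasible_or_infinite:
  assumes "A *v u + B *v w = c"
  shows "f u + g w = \<infinity> \<or> primal_feasible_point f g A B c u w"
  using assms by (auto simp: primal_feasible_point_def eff_dom_def less_top[symmetric])

text \<open>
  Infeasible or infinite points do not affect the infimum.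
\<close>
lemma le_primal_value:
  assumes "\<And>u w p q. \<lbrakk>f u = ereal p; g w = ereal q; b w = - a u\<rbrakk> \<Longrightarrow> L \<le> ereal (p + q)"
  shows "L \<le> primal_value f g A B c"
  unfolding primal_value_def
proof (rule INF_greatest)
  fix uw assume "uw \<in> {(u, w). A *v u + B *v w = c}"
  then obtain u w where uw: "uw = (u, w)" and "A *v u + B *v w = c" by auto
  from this(2) consider "f u + g w = \<infinity>" | "primal_feasible_point f g A B c u w"
    using feasible_or_infinite by blast
  then have "L \<le> f u + g w"
  proof cases
    case 2
    then show ?thesis using assms by (metis feasible_finite plus_ereal.simps(1))
  qed (simp only: ereal_less_eq)
  then show "L \<le> (case uw of (u, w) \<Rightarrow> f u + g w)" by (simp add: uw)
qed

lemma limsup_average_le: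
  "limsup (\<lambda>k. ereal (1 / real k) * (\<Sum>i=1..k. f (x i) + g (y i))) \<le> primal_value f g A B c"
proof (rule le_primal_value)
  fix u w p q assume uw: "f u = ereal p" "g w = ereal q" "b w = - a u"
  have "(\<lambda>k. p + q + energy w 0 * (1 / real k)) \<longlonglongrightarrow> p + q + energy w 0 * 0"
    by (intro tendsto_intros lim_1_over_n)
  then have "limsup (\<lambda>k. ereal (p + q + energy w 0 * (1 / real k))) = ereal (p + q)"
    by (intro lim_imp_Limsup) auto
  moreover have "1 / real k * (\<Sum>i=1..k. \<phi> i + \<psi> i) \<le> p + q + energy w 0 * (1 / real k)"
    if "k \<ge> 1" for k
    using that objective_sum_le[OF uw, of k] by (simp add: field_simps)
  then have "limsup (\<lambda>k. ereal (1 / real k * (\<Sum>i=1..k. \<phi> i + \<psi> i)))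
      \<le> limsup (\<lambda>k. ereal (p + q + energy w 0 * (1 / real k)))"
    by (intro Limsup_mono) (auto simp: eventually_sequentially)
  ultimately show "limsup (\<lambda>k. ereal (1 / real k) * (\<Sum>i=1..k. f (x i) + g (y i))) \<le> ereal (p + q)"
    by (simp only: average_eq)
qed

text \<open>
  If the objective eventually stayed above the value at a feasible point by a fixed amount, the
  energy would decrease linearly and become negative.
\<close>
lemma liminf_objective_le: "liminf (\<lambda>k. f (x k) + g (y k)) \<le> primal_value f g A B c"
proof (rule le_primal_value, rule ccontr)
  fix u w p q assume uw: "f u = ereal p" "g w = ereal q" "b w = - a u"
  assume "\<not> liminf (\<lambda>k. f (x k) + g (y k)) \<le> ereal (p + q)"
  then have "ereal (p + q) < liminf (\<lambda>k. f (x k) + g (y k))" by (simp only: not_le)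
  from ereal_dense2[OF this]
  obtain l where l: "p + q < l" "ereal l < liminf (\<lambda>k. f (x k) + g (y k))" by auto
  then obtain N where N: "\<And>k. k \<ge> N \<Longrightarrow> ereal l < f (x k) + g (y k)"
    using less_LiminfD[OF l(2)] by (auto simp: eventually_sequentially)
  have decrease: "energy w (N + m) \<le> energy w N - real m * (l - (p + q))" for m
  proof (induction m)
    case (Suc m)
    have "l < \<phi> (Suc (N + m)) + \<psi> (Suc (N + m))"
      using N[of "Suc (N + m)"] by (simp add: f_subgradient(1) g_subgradient(1))
    then show ?case using Suc energy_decrease[OF uw, of "N + m"] by (simp add: algebra_simps)
  qed simp
  obtain m where "energy w N < real m * (l - (p + q))"
    using reals_Archimedean3[of "l - (p + q)"] l(1) by auto
  then show False using decrease[of m] energy_nonneg[of w "N + m"] by linarith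
qed

lemma fenchel_young: "ereal (\<mu> \<bullet> u) - h u \<le> conjugate_fun h \<mu>"
  unfolding conjugate_fun_def by (rule SUP_upper) simp

text \<open>
  Weak duality along the iterates: a value \<open>d\<close> of the dual objective other than \<open>-\<infinity>\<close> comes from
  a \<open>\<mu>\<close> with both conjugates finite, and the Fenchel--Young inequalities bound the objective from below,
  up to the pairing of \<open>\<mu>\<close> with the residual.
\<close>
lemma dual_value_le:
  assumes "\<And>\<mu> d. (\<And>k. d - \<mu> \<bullet> (A *v x (Suc k) + B *v y (Suc k) - c) \<le> \<phi> (Suc k) + \<psi> (Suc k))
      \<Longrightarrow> ereal d \<le> L"
  shows "dual_value f g A B c \<le> L"
  unfolding dual_value_def
proof (rule SUP_least)
  fix \<mu>
  let ?F = "conjugate_fun f (- (transpose A *v \<mu>))" and ?G = "conjugate_fun g (- (transpose B *v \<mu>))"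
  have F: "ereal (- (transpose A *v \<mu>) \<bullet> x (Suc k) - \<phi> (Suc k)) \<le> ?F" for k
    using fenchel_young[of "- (transpose A *v \<mu>)" "x (Suc k)" f] by (simp add: f_subgradient(1))
  have G: "ereal (- (transpose B *v \<mu>) \<bullet> y (Suc k) - \<psi> (Suc k)) \<le> ?G" for k
    using fenchel_young[of "- (transpose B *v \<mu>)" "y (Suc k)" g] by (simp add: g_subgradient(1))
  show "- ?F - ?G - ereal (c \<bullet> \<mu>) \<le> L"
  proof (cases "?F = \<infinity> \<or> ?G = \<infinity>")
    case True
    have "?F \<noteq> -\<infinity>" "?G \<noteq> -\<infinity>" using F G by auto
    then have "- ?F - ?G - ereal (c \<bullet> \<mu>) = -\<infinity>"
      using True by (cases ?F; cases ?G) auto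
    then show ?thesis by simp
  next
    case False
    then obtain p q where pq: "?F = ereal p" "?G = ereal q"
      using F[of 0] G[of 0] by (cases ?F; cases ?G) auto
    have "ereal (- p - q - c \<bullet> \<mu>) \<le> L"
    proof (rule assms)
      fix k
      show "- p - q - c \<bullet> \<mu> - \<mu> \<bullet> (A *v x (Suc k) + B *v y (Suc k) - c) \<le> \<phi> (Suc k) + \<psi> (Suc k)"
        using F[of k] G[of k] unfolding pq
        by (simp add: dot_lmul_matrix transpose_matrix_vector inner_simps inner_commute[of c])
    qed
    then show ?thesis by (simp only: pq uminus_ereal.simps ereal_minus)
  qed
qed

lemma liminf_objective_ge:
  assumes "(\<lambda>k. A *v x k + B *v y k - c) \<longlonglongrightarrow> 0"
  shows "dual_value f g A B c \<le> liminf (\<lambda>k. f (x k) + g (y k))"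
proof (rule dual_value_le)
  fix \<mu> d
  assume le: "\<And>k. d - \<mu> \<bullet> (A *v x (Suc k) + B *v y (Suc k) - c) \<le> \<phi> (Suc k) + \<psi> (Suc k)"
  have "(\<lambda>k. d - \<mu> \<bullet> (A *v x k + B *v y k - c)) \<longlonglongrightarrow> d - \<mu> \<bullet> 0"
    by (intro tendsto_intros assms)
  then have "liminf (\<lambda>k. ereal (d - \<mu> \<bullet> (A *v x k + B *v y k - c))) = ereal d"
    by (intro lim_imp_Liminf) auto
  moreover have "ereal (d - \<mu> \<bullet> (A *v x k + B *v y k - c)) \<le> f (x k) + g (y k)" if "k \<ge> 1" for k
    using that le[of "k - 1"] f_subgradient(1)[of "k - 1"] g_subgradient(1)[of "k - 1"] by simp
  then have "liminf (\<lambda>k. ereal (d - \<mu> \<bullet> (A *v x k + B *v y k - c))) \<le> liminf (\<lambda>k. f (x k) + g (y k))"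
    by (intro Liminf_mono) (auto simp: eventually_sequentially)
  ultimately show "ereal d \<le> liminf (\<lambda>k. f (x k) + g (y k))" by simp
qed

lemma liminf_average_ge:
  assumes "(\<lambda>k. A *v x k + B *v y k - c) \<longlonglongrightarrow> 0"
  shows "dual_value f g A B c \<le> liminf (\<lambda>k. ereal (1 / real k) * (\<Sum>i=1..k. f (x i) + g (y i)))"
proof (rule dual_value_le)
  fix \<mu> d
  define r where "r k = A *v x k + B *v y k - c" for k
  assume "\<And>k. d - \<mu> \<bullet> (A *v x (Suc k) + B *v y (Suc k) - c) \<le> \<phi> (Suc k) + \<psi> (Suc k)"
  then have le: "d - \<mu> \<bullet> r (Suc k) \<le> \<phi> (Suc k) + \<psi> (Suc k)" for k by (simp only: r_def)
  have "r \<longlonglongrightarrow> 0" using assms by (simp add: r_def[abs_def])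
  then   have "(\<lambda>k. d - \<mu> \<bullet> ((1 / real k) *\<^sub>R (\<Sum>i=1..k. r i))) \<longlonglongrightarrow> d - \<mu> \<bullet> 0"
    by (intro tendsto_intros cesaro_mean)
  then have "liminf (\<lambda>k. ereal (d - \<mu> \<bullet> ((1 / real k) *\<^sub>R (\<Sum>i=1..k. r i)))) = ereal d"
    by (intro lim_imp_Liminf) auto
  moreover have "d - \<mu> \<bullet> ((1 / real k) *\<^sub>R (\<Sum>i=1..k. r i)) \<le> 1 / real k * (\<Sum>i=1..k. \<phi> i + \<psi> i)"
    if "k \<ge> 1" for k
  proof -
    have "(\<Sum>i=1..k. d - \<mu> \<bullet> r i) \<le> (\<Sum>i=1..k. \<phi> i + \<psi> i)"
    proof (rule sum_mono)
      fix i assume "i \<in> {1..k}"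
      then show "d - \<mu> \<bullet> r i \<le> \<phi> i + \<psi> i" using le[of "i - 1"] by simp
    qed
    then have "real k * d - \<mu> \<bullet> (\<Sum>i=1..k. r i) \<le> (\<Sum>i=1..k. \<phi> i + \<psi> i)"
      by (simp add: sum_subtractf inner_sum_right)
    then have "(real k * d - \<mu> \<bullet> (\<Sum>i=1..k. r i)) / real k \<le> (\<Sum>i=1..k. \<phi> i + \<psi> i) / real k"
      by (rule divide_right_mono) simp
    then show ?thesis using that by (simp add: diff_divide_distrib)
  qed
  then have "liminf (\<lambda>k. ereal (d - \<mu> \<bullet> ((1 / real k) *\<^sub>R (\<Sum>i=1..k. r i))))
      \<le> liminf (\<lambda>k. ereal (1 / real k * (\<Sum>i=1..k. \<phi> i + \<psi> i)))"
    by (intro Liminf_mono) (auto simp: eventually_sequentially)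
  ultimately show "ereal d \<le> liminf (\<lambda>k. ereal (1 / real k) * (\<Sum>i=1..k. f (x i) + g (y i)))"
    by (simp only: average_eq)
qed

end

section \<open>Limits of the iterates\<close>

lemma closed_fun_le_liminf:
  fixes f :: "'a::topological_space \<Rightarrow> ereal"
  assumes "closed_fun f" and X: "X \<longlonglongrightarrow> u"
  shows "f u \<le> liminf (\<lambda>k. f (X k))"
proof (rule ccontr)
  assume "\<not> f u \<le> liminf (\<lambda>k. f (X k))"
  then obtain l where l: "liminf (\<lambda>k. f (X k)) < ereal l" "ereal l < f u"
    by (metis not_le ereal_dense2)
  have "open (- epi f)" using assms(1) by (simp add: closed_fun_def open_Compl)
  moreover have "(u, l) \<in> - epi f" using l(2) by (simp add: epi_def)
  moreover have "(\<lambda>k. (X k, l)) \<longlonglongrightarrow> (u, l)" by (intro tendsto_intros X)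
  ultimately have "\<forall>\<^sub>F k in sequentially. (X k, l) \<in> - epi f"
    by (blast dest: topological_tendstoD)
  then have "ereal l \<le> liminf (\<lambda>k. f (X k))"
    by (intro Liminf_bounded) (auto elim!: eventually_mono simp: epi_def)
  then show False using l(1) by simp
qed

lemma limit_is_primal_solution:
  assumes f: "closed_fun f" "proper_fun f" and g: "closed_fun g" "proper_fun g"
    and X: "x \<longlonglongrightarrow> u" and Y: "y \<longlonglongrightarrow> w"
    and res: "(\<lambda>k. A *v x k + B *v y k - c) \<longlonglongrightarrow> 0"
    and val: "liminf (\<lambda>k. f (x k) + g (y k)) \<le> primal_value f g A B c"
    and fin: "primal_value f g A B c < \<infinity>"
  shows "primal_solution f g A B c u w"
proof -
  have "(\<lambda>k. A *v x k + B *v y k - c) \<longlonglongrightarrow> A *v u + B *v w - c"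
    by (intro tendsto_intros matrix_vector_mul_bounded_linear[THEN bounded_linear.tendsto] X Y)
  then have feas: "A *v u + B *v w = c"
    using LIMSEQ_unique[OF res] by fastforce
  have lsc: "f u \<le> liminf (\<lambda>k. f (x k))" "g w \<le> liminf (\<lambda>k. g (y k))"
    by (intro closed_fun_le_liminf f g X Y)+
  have fg: "f u \<noteq> -\<infinity>" "g w \<noteq> -\<infinity>" using f g by (auto simp: proper_fun_def)
  have "f u + g w \<le> liminf (\<lambda>k. f (x k)) + liminf (\<lambda>k. g (y k))"
    by (intro add_mono lsc)
  also have "\<dots> \<le> liminf (\<lambda>k. f (x k) + g (y k))"
    by (rule ereal_liminf_add_mono) (use lsc fg in auto)
  finally have le: "f u + g w \<le> primal_value f g A B c" using val by simp
  moreover have "primal_value f g A B c \<le> f u + g w"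
    unfolding primal_value_def by (rule INF_lower2[of "(u, w)"]) (use feas in auto)
  moreover have "f u \<noteq> \<infinity>" "g w \<noteq> \<infinity>" using le fin fg by auto
  ultimately show ?thesis
    using feas by (auto simp: primal_solution_def primal_feasible_point_def eff_dom_def less_top[symmetric])
qed

section \<open>Convergence without a primal solution\<close>

theorem theorem13:
  fixes f :: "real^'p \<Rightarrow> ereal" and g :: "real^'q \<Rightarrow> ereal"
    and A :: "real^'p^'n" and B :: "real^'q^'n" and c :: "real^'n" and \<gamma> :: real
    and x :: "nat \<Rightarrow> real^'p" and y :: "nat \<Rightarrow> real^'q" and \<nu> :: "nat \<Rightarrow> real^'n"
  assumes "closed_fun f" and "proper_fun f" and "convex_fun f"
    and "closed_fun g" and "proper_fun g" and "convex_fun g"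
    and "\<gamma> > 0"
    and "range (\<lambda>\<mu>. transpose A *v \<mu>) \<inter> rel_interior (eff_dom (conjugate_fun f)) \<noteq> {}"
    and "range (\<lambda>\<mu>. transpose B *v \<mu>) \<inter> rel_interior (eff_dom (conjugate_fun g)) \<noteq> {}"
    and "admm_sequence f g A B c \<gamma> x y \<nu>"
    and "dual_value f g A B c = primal_value f g A B c"
    and "primal_value f g A B c < \<infinity>"
    and "primal_feasible f g A B c"
    and "\<nexists>u w. primal_solution f g A B c u w"
  shows "(\<lambda>k. A *v x k + B *v y k - c) \<longlonglongrightarrow> 0
    \<and> (\<lambda>k. ereal (1 / real k) * (\<Sum>i = 1..k. f (x i) + g (y i))) \<longlonglongrightarrow> primal_value f g A B c
    \<and> liminf (\<lambda>k. f (x k) + g (y k)) = primal_value f g A B c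
    \<and> \<not> convergent (\<lambda>k. (x k, y k))"
proof -
  interpret admm_run f g A B c \<gamma> x y \<nu>
    by unfold_locales (use assms in auto)
  let ?avg = "\<lambda>k. ereal (1 / real k) * (\<Sum>i = 1..k. f (x i) + g (y i))"
  obtain u w where "primal_feasible_point f g A B c u w"
    using assms(13) by (auto simp: primal_feasible_def)
  then have residual: "(\<lambda>k. A *v x k + B *v y k - c) \<longlonglongrightarrow> 0"
    by (rule primal_residual_tendsto)
  have "liminf ?avg \<le> limsup ?avg"
    by (rule Liminf_le_Limsup) simp
  then have "liminf ?avg = primal_value f g A B c" "limsup ?avg = primal_value f g A B c"
    using limsup_average_le liminf_average_ge[OF residual] assms(11) by simp_all
  then have average: "?avg \<longlonglongrightarrow> primal_value f g A B c"
    by (simp add: tendsto_iff_Liminf_eq_Limsup)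
  have objective: "liminf (\<lambda>k. f (x k) + g (y k)) = primal_value f g A B c"
    using liminf_objective_le liminf_objective_ge[OF residual] assms(11) by (simp add: antisym)
  have "\<not> convergent (\<lambda>k. (x k, y k))"
  proof
    assume "convergent (\<lambda>k. (x k, y k))"
    then obtain u w where "(\<lambda>k. (x k, y k)) \<longlonglongrightarrow> (u, w)"
      by (auto simp: convergent_def)
    then have "x \<longlonglongrightarrow> u" "y \<longlonglongrightarrow> w"
      by (auto dest: tendsto_fst tendsto_snd)
    then have "primal_solution f g A B c u w"
      using objective assms(12)
      by (intro limit_is_primal_solution[OF assms(1,2,4,5) _ _ residual]) simp_all
    then show False using assms(14) by blast
  qed
  with residual average objective show ?thesis by blast
qed

end
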